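(* There exists a separable metric space which satisfies the Besicovitch covering property, but for which the strong Besicovitch covering property fails.
   Context: Let $(X,d)$ be a (nonempty) metric space. Balls are sets of points, of the form $B^{\mathrm{o}}(x,r)=\{y\in X: d(x,y)<r\}$ (open balls) or $B^{\mathrm{cl}}(x,r)=\{y\in X: d(x,y)\le r\}$ (closed balls), with $r>0$. $B(x,r)$ denotes a ball without specifying which kind, but all balls under consideration are of the same kind (all open or all closed). Centers and radii of a ball are in general not unique: $x$ is a center of the ball $B$ if $B=B(x,r)$ for some $r>0$. Collections of balls are collections of sets (the same set written with different centers and radii counts as one ball). Collections of balls are assumed nonempty. A collection of sets is disjoint if its members are pairwise disjoint. A collection $\mathcal{C}$ of balls is uniformly bounded if there exists $R>0$ such that for every $B\in\mathcal{C}$ there is a choice of center $x$ and radius $r$ with $B=B(x,r)$ and $r\le R$. A collection $\mathcal{C}$ of balls is a centered cover of $A\subset X$ if for every $x\in A$ there exists a ball $B\in\mathcal{C}$ such that $x$ is a center of $B$. $(X,d)$ has the strong Besicovitch covering property if there exists a constant $L\ge 1$ such that for every $A\subset X$ and every uniformly bounded centered cover $\mathcal{C}$ of $A$, for some $m\le L$ there are disjoint subcollections $\mathcal{C}_1,\dots,\mathcal{C}_m$ of $\mathcal{C}$ such that $A\subset\bigcup_{i=1}^m\bigcup\mathcal{C}_i$. $(X,d)$ has the Besicovitch covering property if there exists a constant $L\ge 1$ such that for every $A\subset X$ and every uniformly bounded centered cover $\mathcal{C}$ of $A$, there is a subcollection $\mathcal{C}'\subset\mathcal{C}$ satisfying $\mathbf{1}_A\le\sum_{B\in\mathcal{C}'}\mathbf{1}_B\le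 L$. *)

theory Defs
  imports "HOL-Analysis.Analysis"
begin

text \<open>
  The notions below are parameterised by the kind of balls in use, since all balls under
  consideration are either all open or all closed. A ball is a plain set of points: its center and
  radius are not part of the data and need not be unique.
\<close>

datatype ball_kind = Open_Balls | Closed_Balls

fun kball :: "ball_kind \<Rightarrow> 'a metric \<Rightarrow> 'a \<Rightarrow> real \<Rightarrow> 'a set" where
  "kball Open_Balls X x r = mball_of X x r"
| "kball Closed_Balls X x r = mcball_of X x r"

definition is_center :: "ball_kind \<Rightarrow> 'a metric \<Rightarrow> 'a \<Rightarrow> 'a set \<Rightarrow> bool" where
  "is_center k X x B \<longleftrightarrow> x \<in> mspace X \<and> (\<exists>r>0. B = kball k X x r)"

definition ball_collection :: "ball_kind \<Rightarrow> 'a metric \<Rightarrow> 'a set set \<Rightarrow> bool" where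
  "ball_collection k X \<C> \<longleftrightarrow> \<C> \<noteq> {} \<and> (\<forall>B\<in>\<C>. \<exists>x. is_center k X x B)"

definition uniformly_bounded_balls :: "ball_kind \<Rightarrow> 'a metric \<Rightarrow> 'a set set \<Rightarrow> bool" where
  "uniformly_bounded_balls k X \<C> \<longleftrightarrow>
     (\<exists>R>0. \<forall>B\<in>\<C>. \<exists>x\<in>mspace X. \<exists>r>0. B = kball k X x r \<and> r \<le> R)"

definition centered_cover :: "ball_kind \<Rightarrow> 'a metric \<Rightarrow> 'a set \<Rightarrow> 'a set set \<Rightarrow> bool" where
  "centered_cover k X A \<C> \<longleftrightarrow>
     ball_collection k X \<C> \<and> (\<forall>x\<in>A. \<exists>B\<in>\<C>. is_center k X x B)"

definition strong_besicovitch :: "ball_kind \<Rightarrow> 'a metric \<Rightarrow> bool" where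
  "strong_besicovitch k X \<longleftrightarrow>
     (\<exists>L::real. L \<ge> 1 \<and>
       (\<forall>A \<C>. A \<subseteq> mspace X \<longrightarrow> centered_cover k X A \<C> \<longrightarrow> uniformly_bounded_balls k X \<C> \<longrightarrow>
         (\<exists>(m::nat) (\<D> :: nat \<Rightarrow> 'a set set). real m \<le> L \<and>
            (\<forall>i\<in>{1..m}. \<D> i \<noteq> {} \<and> \<D> i \<subseteq> \<C> \<and> disjoint (\<D> i)) \<and>
            A \<subseteq> (\<Union>i\<in>{1..m}. \<Union>(\<D> i)))))"

text \<open>
  The sum of indicators ranges over a possibly infinite collection, so it is taken in
  \<^typ>\<open>ennreal\<close>, where every such sum exists.
\<close>

definition besicovitch :: "ball_kind \<Rightarrow> 'a metric \<Rightarrow> bool" where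
  "besicovitch k X \<longleftrightarrow>
     (\<exists>L::real. L \<ge> 1 \<and>
       (\<forall>A \<C>. A \<subseteq> mspace X \<longrightarrow> centered_cover k X A \<C> \<longrightarrow> uniformly_bounded_balls k X \<C> \<longrightarrow>
         (\<exists>\<C>'. \<C>' \<noteq> {} \<and> \<C>' \<subseteq> \<C> \<and>
           (\<forall>x\<in>mspace X.
              (indicator A x :: ennreal) \<le> (\<Sum>\<^sub>\<infinity>B\<in>\<C>'. indicator B x) \<and>
              (\<Sum>\<^sub>\<infinity>B\<in>\<C>'. indicator B x) \<le> ennreal L))))"

end

theory Submission
  imports Defs
begin

text \<open>
  The space has vertices \<open>x\<^sub>i\<close> and, for each pair of vertices, an edge point \<open>p\<^sub>i\<^sub>j\<close>. Distinct points
  have distance 1 between edges, 2 between an edge and its endpoints, and 3 otherwise. The balls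
  of radius \<open>5/2\<close> around the vertices pairwise meet, and each contains only one vertex, so disjoint
  families of them cover at most one vertex each. On the other hand an edge point lies in only two
  of them, and any ball around an edge point that is not a singleton already contains all edge
  points, so that one such ball suffices for the edges. This gives multiplicity at most 3.
\<close>

section \<open>Incidence of vertices and edges, and the metric\<close>

text \<open>Vertices are encoded as the negative integers and edges as the nonnegative ones.\<close>

definition incident :: "real \<Rightarrow> real \<Rightarrow> bool" where
  "incident u v \<longleftrightarrow>
     (\<exists>i j. v = real (prod_encode (i, j)) \<and> (u = -1 - real i \<or> u = -1 - real j))"

definition gdist :: "real \<Rightarrow> real \<Rightarrow> real" where
  "gdist u v =
     (if u = v then 0
      else if 0 \<le> u \<and> 0 \<le> v then 1
      else if incident u v \<or> incident v u then 2
      else 3)"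

definition graph_metric :: "real metric" where
  "graph_metric = metric (\<int>, gdist)"

text \<open>A description of the vertex balls of radius 5/2 that does not mention the kind of ball.
  For \<open>u \<ge> 0\<close> nothing is incident to the right of \<open>u\<close>, so the set
  degenerates to a singleton.\<close>

definition star :: "real \<Rightarrow> real set" where
  "star u = insert u {v. incident u v}"

lemma incident_sign: "incident u v \<Longrightarrow> u < 0 \<and> 0 \<le> v"
  by (auto simp: incident_def)

lemma incident_Ints: "incident u v \<Longrightarrow> u \<in> \<int> \<and> v \<in> \<int>"
  by (auto simp: incident_def)

text \<open>An edge code determines its pair of indices because \<open>prod_encode\<close> is
  injective. The two values may coincide, as for the loop coded by \<open>(i, i)\<close>.\<close>

lemma incident_at_most_two: "\<exists>a b. \<forall>u. incident u v \<longrightarrow> u = a \<or> u = b"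
proof (cases "\<exists>i j. v = real (prod_encode (i, j))")
  case True
  then obtain i j where v: "v = real (prod_encode (i, j))" by blast
  have "u = -1 - real i \<or> u = -1 - real j" if "incident u v" for u
    using that unfolding incident_def v by auto
  then show ?thesis by blast
qed (auto simp: incident_def)

lemma negative_Ints_cases:
  assumes "u \<in> \<int>" "u < (0::real)"
  obtains i :: nat where "u = -1 - real i"
proof -
  obtain z where z: "u = of_int z" using assms(1) by (auto elim: Ints_cases)
  then have "u = -1 - real (nat (-1 - z))" using assms(2) by auto
  then show thesis by (rule that)
qed

text \<open>Every pair of indices has a code, including pairs with equal entries, so the case
  \<open>u = u'\<close> needs no separate treatment. This makes any two stars meet.\<close>

lemma common_edge:
  assumes "u \<in> \<int>" "u < 0" "u' \<in> \<int>" "u' < 0"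
  shows "\<exists>v. incident u v \<and> incident u' v"
proof -
  obtain i where i: "u = -1 - real i" using assms negative_Ints_cases by blast
  obtain j where j: "u' = -1 - real j" using assms negative_Ints_cases by blast
  have "incident u (real (prod_encode (i, j)))" "incident u' (real (prod_encode (i, j)))"
    unfolding incident_def i j by blast+
  then show ?thesis by blast
qed

lemma gdist_values: "gdist u v \<in> {0, 1, 2, 3}"
  by (simp add: gdist_def)

lemma gdist_eq_1_iff: "gdist u v = 1 \<longleftrightarrow> u \<noteq> v \<and> 0 \<le> u \<and> 0 \<le> v"
  by (simp add: gdist_def)

text \<open>For distances in \<open>{1, 2, 3}\<close> only \<open>3 > 1 + 1\<close> could violate the triangle inequality.\<close>

lemma Metric_space_gdist: "Metric_space \<int> gdist"
proof
  fix u v w :: real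
  show "0 \<le> gdist u v" "gdist u v = gdist v u" "gdist u v = 0 \<longleftrightarrow> u = v"
    by (auto simp: gdist_def)
  show "gdist u w \<le> gdist u v + gdist v w"
  proof (cases "gdist u v = 1 \<and> gdist v w = 1")
    case True
    then have "gdist u w \<le> 1" unfolding gdist_eq_1_iff by (simp add: gdist_def)
    with True show ?thesis by simp
  next
    case False
    show ?thesis
    proof (cases "u = v \<or> v = w")
      case True
      then show ?thesis by (auto simp: gdist_def)
    next
      case neq: False
      have "gdist u w \<le> 3" by (simp add: gdist_def)
      also have "3 \<le> gdist u v + gdist v w" using False neq unfolding gdist_eq_1_iff by (simp add: gdist_def)
      finally show ?thesis .
    qed
  qed
qed

lemma mspace_graph_metric [simp]: "mspace graph_metric = \<int>"
  and mdist_graph_metric [simp]: "mdist graph_metric = gdist"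
  using Metric_space_gdist
  by (simp_all add: graph_metric_def Metric_space.mspace_metric Metric_space.mdist_metric)

section \<open>Classification of the balls, open or closed\<close>

lemma kball_graph_metric:
  assumes "c \<in> \<int>"
  shows "kball k graph_metric c r =
    {y \<in> \<int>. case k of Open_Balls \<Rightarrow> gdist c y < r | Closed_Balls \<Rightarrow> gdist c y \<le> r}"
  using assms by (cases k) auto

text \<open>The radius 5/2 lies strictly between the distances 2 and 3, so strict and weak
  inequality select the same points.\<close>

lemma kball_vertex_star:
  assumes "c \<in> \<int>" "c < 0"
  shows "kball k graph_metric c (5/2) = star c"
  unfolding kball_graph_metric[OF assms(1)] star_def
  using assms by (cases k) (auto simp: gdist_def dest: incident_sign incident_Ints split: if_splits)

text \<open>Distances take only four values, so a ball of either kind is a sublevel set at the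
  largest value that its radius admits. From here on the kind of ball is irrelevant to its
  shape.\<close>

lemma kball_cases:
  assumes "c \<in> \<int>" "r > 0" "B = kball k graph_metric c r"
  obtains t where "t \<ge> 0" "B = {y \<in> \<int>. gdist c y \<le> t}" "t \<in> {0, 1, 2, 3}"
proof -
  define S :: "real set" where
    "S = {t \<in> {0,1,2,3}. case k of Open_Balls \<Rightarrow> t < r | Closed_Balls \<Rightarrow> t \<le> r}"
  have S: "finite S" "0 \<in> S" using assms(2) by (auto simp: S_def split: ball_kind.splits)
  have mem: "gdist c y \<le> Max S \<longleftrightarrow>
      (case k of Open_Balls \<Rightarrow> gdist c y < r | Closed_Balls \<Rightarrow> gdist c y \<le> r)" for y
  proof
    assume *: "gdist c y \<le> Max S"
    have "Max S \<in> S" using S by (intro Max_in) auto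
    with * show "case k of Open_Balls \<Rightarrow> gdist c y < r | Closed_Balls \<Rightarrow> gdist c y \<le> r"
      by (auto simp: S_def split: ball_kind.splits)
  next
    assume "case k of Open_Balls \<Rightarrow> gdist c y < r | Closed_Balls \<Rightarrow> gdist c y \<le> r"
    then have "gdist c y \<in> S" using gdist_values[of c y] by (simp add: S_def)
    then show "gdist c y \<le> Max S" using S by simp
  qed
  have "Max S \<in> S" using S by (intro Max_in) auto
  then show thesis
    using that[of "Max S"] unfolding assms(3) kball_graph_metric[OF assms(1)] mem
    by (auto simp: S_def)
qed

lemma is_center_vertex_cases:
  assumes "is_center k graph_metric c B" "c < 0"
  shows "B = {c} \<or> B = star c \<or> B = \<int>"
proof -
  have c: "c \<in> \<int>" using assms(1) by (simp add: is_center_def)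
  obtain t where t: "B = {y \<in> \<int>. gdist c y \<le> t}" "t \<in> {0, 1, 2, 3}"
    using assms(1) unfolding is_center_def mspace_graph_metric by (metis kball_cases)
  \<comment> \<open>No point is at distance 1 from a vertex, so the thresholds 0 and 1 give the same
    set.\<close>
  have "{y \<in> \<int>. gdist c y \<le> 0} = {c}" "{y \<in> \<int>. gdist c y \<le> 1} = {c}"
    "{y \<in> \<int>. gdist c y \<le> 2} = star c" "{y \<in> \<int>. gdist c y \<le> 3} = \<int>"
    using c assms(2)
    by (auto simp: gdist_def star_def dest: incident_sign incident_Ints split: if_splits)
  then show ?thesis using t by auto
qed

text \<open>Edge points are at mutual distance at most 1, so every threshold above 0 admits all of
  them.\<close>

lemma is_center_edge_cases:
  assumes "is_center k graph_metric c B" "0 \<le> c"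
  shows "B = {c} \<or> {y \<in> \<int>. 0 \<le> y} \<subseteq> B"
proof -
  have c: "c \<in> \<int>" using assms(1) by (simp add: is_center_def)
  obtain t where t: "B = {y \<in> \<int>. gdist c y \<le> t}" "t \<in> {0, 1, 2, 3}"
    using assms(1) unfolding is_center_def mspace_graph_metric by (metis kball_cases)
  have "{y \<in> \<int>. gdist c y \<le> 0} = {c}"
    using c by (auto simp: gdist_def split: if_splits)
  moreover have "{y \<in> \<int>. 0 \<le> y} \<subseteq> {y \<in> \<int>. gdist c y \<le> t}" if "1 \<le> t"
  proof (intro subsetI CollectI conjI; elim CollectE conjE)
    fix y :: real assume "0 \<le> y"
    then have "gdist c y \<le> 1" using assms(2) by (simp add: gdist_def)
    also note that
    finally show "gdist c y \<le> t" .
  qed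
  moreover have "t = 0 \<or> 1 \<le> t" using t(2) by auto
  ultimately show ?thesis unfolding t(1) by metis
qed

section \<open>Subcovers of multiplicity at most 3\<close>

lemma infsum_indicator_eq_card:
  assumes "finite {B \<in> \<C>. y \<in> B}"
  shows "(\<Sum>\<^sub>\<infinity>B\<in>\<C>. indicator B y :: ennreal) = of_nat (card {B \<in> \<C>. y \<in> B})"
proof -
  have "(\<Sum>\<^sub>\<infinity>B\<in>\<C>. indicator B y :: ennreal) = (\<Sum>\<^sub>\<infinity>B\<in>{B \<in> \<C>. y \<in> B}. 1)"
    by (rule infsum_cong_neutral) auto
  then show ?thesis using assms by simp
qed

lemma indicator_sum_bounds:
  assumes "A \<subseteq> \<Union>\<C>" and "\<And>y. y \<in> M \<Longrightarrow> finite {B \<in> \<C>. y \<in> B} \<and> card {B \<in> \<C>. y \<in> B} \<le> n"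
  shows "\<forall>y\<in>M. (indicator A y :: ennreal) \<le> (\<Sum>\<^sub>\<infinity>B\<in>\<C>. indicator B y) \<and>
    (\<Sum>\<^sub>\<infinity>B\<in>\<C>. indicator B y) \<le> ennreal (real n)"
proof (intro ballI conjI)
  fix y assume "y \<in> M"
  then have y: "finite {B \<in> \<C>. y \<in> B}" "card {B \<in> \<C>. y \<in> B} \<le> n" using assms(2) by auto
  show "(indicator A y :: ennreal) \<le> (\<Sum>\<^sub>\<infinity>B\<in>\<C>. indicator B y)"
  proof (cases "y \<in> A")
    case True
    then have "{B \<in> \<C>. y \<in> B} \<noteq> {}" using assms(1) by blast
    then have "1 \<le> card {B \<in> \<C>. y \<in> B}" using y(1) by (simp add: Suc_le_eq card_gt_0_iff)
    then have "(of_nat 1 :: ennreal) \<le> of_nat (card {B \<in> \<C>. y \<in> B})" by (rule of_nat_mono)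
    then show ?thesis using True by (simp add: infsum_indicator_eq_card[OF y(1)])
  qed simp
  show "(\<Sum>\<^sub>\<infinity>B\<in>\<C>. indicator B y) \<le> ennreal (real n)"
    using of_nat_mono[OF y(2), where 'a = ennreal]
    by (simp add: infsum_indicator_eq_card[OF y(1)] ennreal_of_nat_eq_real_of_nat)
qed

lemma exists_subcover_multiplicity_3:
  assumes "A \<subseteq> \<int>" and cov: "centered_cover k graph_metric A \<C>"
  shows "\<exists>\<C>'. \<C>' \<noteq> {} \<and> \<C>' \<subseteq> \<C> \<and> A \<subseteq> \<Union>\<C>' \<and>
    (\<forall>y\<in>\<int>. finite {B \<in> \<C>'. y \<in> B} \<and> card {B \<in> \<C>'. y \<in> B} \<le> 3)"
proof -
  \<comment> \<open>Settles two cases: the whole space belongs to the cover, or \<open>A\<close> is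
    empty and any ball serves, since the subcollection must be nonempty.\<close>
  have single: ?thesis if "B\<^sub>0 \<in> \<C>" "A \<subseteq> B\<^sub>0" for B\<^sub>0
  proof -
    have "{B \<in> {B\<^sub>0}. y \<in> B} \<subseteq> {B\<^sub>0}" for y by auto
    then have "card {B \<in> {B\<^sub>0}. y \<in> B} \<le> 3" for y
      using card_mono[of "{B\<^sub>0}" "{B \<in> {B\<^sub>0}. y \<in> B}"] by simp
    then show ?thesis using that by (intro exI[of _ "{B\<^sub>0}"]) auto
  qed
  consider (whole) "\<int> \<in> \<C>" | (empty) "A = {}" | (proper) "\<int> \<notin> \<C>" "A \<noteq> {}" by blast
  then show ?thesis
  proof cases
    case whole
    then show ?thesis using single assms(1) by blast
  next
    case empty
    obtain B where "B \<in> \<C>" using cov by (auto simp: centered_cover_def ball_collection_def)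
    then show ?thesis using single empty by blast
  next
    case proper
    obtain b where b: "\<And>x. x \<in> A \<Longrightarrow> b x \<in> \<C> \<and> is_center k graph_metric x (b x)"
      using cov unfolding centered_cover_def by metis
    have vertex: "b x = {x} \<or> b x = star x" if "x \<in> A" "x < 0" for x
      using is_center_vertex_cases[of k x "b x"] b[OF that(1)] that proper(1) by metis
    \<comment> \<open>\<open>G\<close> covers the edge points of \<open>A\<close> with multiplicity
      at most 1: either one ball containing all edge points, or the chosen singletons. The bound is
      phrased through a candidate \<open>g\<close>, which is arbitrary when no member of
      \<open>G\<close> contains \<open>y\<close>.\<close>
    have "\<exists>G \<subseteq> \<C>. {x \<in> A. 0 \<le> x} \<subseteq> \<Union>G \<and> (\<forall>y. \<exists>g. \<forall>B\<in>G. y \<in> B \<longrightarrow> B = g)"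
    proof (cases "\<exists>Q\<in>\<C>. {y \<in> \<int>. 0 \<le> y} \<subseteq> Q")
      case True
      then obtain Q where Q: "Q \<in> \<C>" "{y \<in> \<int>. 0 \<le> y} \<subseteq> Q" by blast
      then show ?thesis using assms(1) by (intro exI[of _ "{Q}"]) auto
    next
      case False
      then have "b x = {x}" if "x \<in> A" "0 \<le> x" for x
        using is_center_edge_cases[of k x "b x"] b[OF that(1)] that by metis
      then have sing: "b ` {x \<in> A. 0 \<le> x} = (\<lambda>x. {x}) ` {x \<in> A. 0 \<le> x}" by auto
      show ?thesis
      proof (intro exI conjI)
        show "b ` {x \<in> A. 0 \<le> x} \<subseteq> \<C>" using b by auto
        show "{x \<in> A. 0 \<le> x} \<subseteq> \<Union>(b ` {x \<in> A. 0 \<le> x})" unfolding sing by auto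
        show "\<forall>y. \<exists>g. \<forall>B\<in>b ` {x \<in> A. 0 \<le> x}. y \<in> B \<longrightarrow> B = g" unfolding sing by auto
      qed
    qed
    then obtain G where G: "G \<subseteq> \<C>" "{x \<in> A. 0 \<le> x} \<subseteq> \<Union>G"
      "\<And>y. \<exists>g. \<forall>B\<in>G. y \<in> B \<longrightarrow> B = g" by metis
    define \<C>' where "\<C>' = G \<union> b ` {x \<in> A. x < 0}"
    have cover: "A \<subseteq> \<Union>\<C>'"
    proof
      fix x assume "x \<in> A"
      then show "x \<in> \<Union>\<C>'"
        using G(2) vertex[of x] unfolding \<C>'_def star_def by (cases "x < 0") auto
    qed
    have "finite {B \<in> \<C>'. y \<in> B} \<and> card {B \<in> \<C>'. y \<in> B} \<le> 3" for y
    proof -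
      obtain g where g: "\<And>B. B \<in> G \<Longrightarrow> y \<in> B \<Longrightarrow> B = g" using G(3) by metis
      \<comment> \<open>If \<open>y\<close> is an edge point, \<open>p\<close> and \<open>q\<close>
        account for its endpoints; if \<open>y\<close> is a vertex, the only \<open>u\<close>
        allowed is \<open>y\<close> itself.\<close>
      obtain p q where pq: "\<And>u. u = y \<and> y < 0 \<or> incident u y \<Longrightarrow> u = p \<or> u = q"
        using incident_at_most_two[of y] incident_sign by (metis not_less)
      have "x = p \<or> x = q" if "x \<in> A" "x < 0" "y \<in> b x" for x
        using vertex[OF that(1,2)] that pq[of x] by (auto simp: star_def)
      \<comment> \<open>One ball from \<open>G\<close> and two vertex balls give the constant 3.
        Only an inclusion is claimed, so \<open>p\<close> and \<open>q\<close> may lie outside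
        \<open>A\<close>.\<close>
      then have sub: "{B \<in> \<C>'. y \<in> B} \<subseteq> {g, b p, b q}"
        using g unfolding \<C>'_def by auto
      moreover have "card {g, b p, b q} \<le> 3"
        using card_length[of "[g, b p, b q]"] by simp
      ultimately show ?thesis
        using card_mono[OF _ sub] finite_subset[OF sub] by simp
    qed
    moreover have "\<C>' \<subseteq> \<C>" using G(1) b by (auto simp: \<C>'_def)
    moreover have "\<C>' \<noteq> {}" using cover proper(2) by auto
    ultimately show ?thesis using cover by blast
  qed
qed

lemma besicovitch_graph_metric: "besicovitch k graph_metric"
  unfolding besicovitch_def mspace_graph_metric
proof (intro exI[of _ "real 3"] conjI allI impI)
  fix A \<C> assume "A \<subseteq> \<int>" "centered_cover k graph_metric A \<C>"
  then obtain \<C>' where C': "\<C>' \<noteq> {}" "\<C>' \<subseteq> \<C>" "A \<subseteq> \<Union>\<C>'"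
    "\<And>y. y \<in> \<int> \<Longrightarrow> finite {B \<in> \<C>'. y \<in> B} \<and> card {B \<in> \<C>'. y \<in> B} \<le> 3"
    using exists_subcover_multiplicity_3 by metis
  show "\<exists>\<C>'. \<C>' \<noteq> {} \<and> \<C>' \<subseteq> \<C> \<and>
    (\<forall>x\<in>\<int>. (indicator A x :: ennreal) \<le> (\<Sum>\<^sub>\<infinity>B\<in>\<C>'. indicator B x) \<and>
      (\<Sum>\<^sub>\<infinity>B\<in>\<C>'. indicator B x) \<le> ennreal (real 3))"
    using C'(1,2) indicator_sum_bounds[OF C'(3,4)] by blast
qed simp

section \<open>Failure of the strong property, and separability\<close>

lemma not_strong_besicovitch_graph_metric: "\<not> strong_besicovitch k graph_metric"
proof
  define V where "V = {u \<in> \<int>. u < (0::real)}"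
  have "infinite (range (\<lambda>i::nat. -1 - real i))"
    by (intro range_inj_infinite) (auto simp: inj_def)
  moreover have "range (\<lambda>i::nat. -1 - real i) \<subseteq> V" by (auto simp: V_def)
  ultimately have inf: "infinite V" using finite_subset by blast
  have ball: "star u = kball k graph_metric u (5/2)" if "u \<in> V" for u
    using kball_vertex_star that by (simp add: V_def)
  have center: "is_center k graph_metric u (star u)" if "u \<in> V" for u
    unfolding is_center_def using ball[OF that] that
    by (auto simp: V_def intro!: exI[of _ "5/2"])
  have "centered_cover k graph_metric V (star ` V)"
    unfolding centered_cover_def ball_collection_def using center inf by auto
  moreover have "uniformly_bounded_balls k graph_metric (star ` V)"
    unfolding uniformly_bounded_balls_def mspace_graph_metric
  proof (intro exI[of _ "5/2"] conjI ballI)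
    fix B assume "B \<in> star ` V"
    then obtain u where "u \<in> V" "B = star u" by blast
    then show "\<exists>x\<in>\<int>. \<exists>r>0. B = kball k graph_metric x r \<and> r \<le> 5/2"
      using ball[of u] by (intro bexI[of _ u] exI[of _ "5/2"]) (auto simp: V_def)
  qed simp
  moreover assume "strong_besicovitch k graph_metric"
  moreover have "V \<subseteq> mspace graph_metric" by (auto simp: V_def)
  ultimately obtain m :: nat and \<D> where
    D: "\<And>i. i \<in> {1..m} \<Longrightarrow> \<D> i \<subseteq> star ` V \<and> disjoint (\<D> i)" and
    cover: "V \<subseteq> (\<Union>i\<in>{1..m}. \<Union>(\<D> i))"
    unfolding strong_besicovitch_def by metis
  \<comment> \<open>Stars of vertices pairwise meet, so a disjoint family of them has at most one
    member, and that member contains a single vertex.\<close>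
  have "finite (V \<inter> \<Union>(\<D> i))" if "i \<in> {1..m}" for i
  proof -
    have meet: "star u \<inter> star u' \<noteq> {}" if "u \<in> V" "u' \<in> V" for u u'
      using common_edge[of u u'] that by (auto simp: V_def star_def)
    have vert: "V \<inter> star u \<subseteq> {u}" for u
      by (auto simp: V_def star_def dest: incident_sign)
    have "V \<inter> \<Union>(\<D> i) \<subseteq> {u}" if "star u \<in> \<D> i" "u \<in> V" for u
    proof -
      have "B = star u" if "B \<in> \<D> i" for B
      proof -
        have "B \<in> star ` V" using D[OF \<open>i \<in> {1..m}\<close>] that by (meson subsetD)
        then obtain u' where u': "u' \<in> V" "B = star u'" by (rule imageE)
        have "B \<inter> star u \<noteq> {}" unfolding u'(2) by (rule meet[OF u'(1) \<open>u \<in> V\<close>])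
        moreover have "disjoint (\<D> i)" using D[OF \<open>i \<in> {1..m}\<close>] ..
        ultimately show ?thesis using that \<open>star u \<in> \<D> i\<close> by (metis disjointD)
      qed
      then show ?thesis using vert[of u] by blast
    qed
    moreover have "\<D> i = {} \<or> (\<exists>u\<in>V. star u \<in> \<D> i)" using D[OF that] by blast
    ultimately show ?thesis
      by (metis Union_empty finite.emptyI finite_insert finite_subset inf_bot_right)
  qed
  \<comment> \<open>Finitely many disjoint families thus never cover the infinite set
    \<open>V\<close>, whatever bound is put on \<open>m\<close>.\<close>
  then have "finite (\<Union>i\<in>{1..m}. V \<inter> \<Union>(\<D> i))" by blast
  moreover have "V \<subseteq> (\<Union>i\<in>{1..m}. V \<inter> \<Union>(\<D> i))" using cover by blast
  ultimately show False using inf finite_subset by blast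
qed

lemma separable_graph_metric: "separable_space (mtopology_of graph_metric)"
proof -
  have "countable (\<int> :: real set)" unfolding Ints_def by (intro countable_image) auto
  then have "countable (topspace (mtopology_of graph_metric))" by simp
  \<comment> \<open>The countable dense set is the whole space.\<close>
  then show ?thesis
    unfolding separable_space_def
    by (metis closure_of_topspace order_refl)
qed

theorem theorem2p11:
  shows "\<exists>X :: real metric.
           mspace X \<noteq> {} \<and> separable_space (mtopology_of X) \<and>
           (\<forall>k. besicovitch k X \<and> \<not> strong_besicovitch k X)"
  using separable_graph_metric besicovitch_graph_metric not_strong_besicovitch_graph_metric
  by (intro exI[of _ graph_metric]) auto

end
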